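(* Let $p_1,p_2,p_3$ be three distinct primes and let $\omega\in\{2,4\}$ be an integer whose residue is a primitive cube root of unity in $\mathbb{F}_7$. Then the sets $$B_1=\{p_1,p_2,p_3,p_1p_2^3,p_1p_3^3,p_2p_3^3,p_1p_2^{5},p_1p_3^{5},p_2p_3^{5},p_1p_2^{6},p_1p_3^{6},p_2p_3^{6}\}$$ and $$B_2=\{p_1,p_2,p_3,p_1p_2p_3,p_1^{\omega^2}p_2^{\omega}p_3,p_1^{\omega^2}p_2p_3^{\omega},p_1^{\omega}p_2^{\omega}p_3,p_1p_2^{\omega}p_3,p_1^{\omega}p_2p_3,p_1^{\omega}p_2p_3^{\omega},p_1p_2^{\omega}p_3^{\omega},p_1p_2p_3^{\omega}\}$$ are locally $7^{th}$ power sets of size $12=\frac{3(7+1)}{2}$ which are not geometrically $7$-equivalent.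
   Context: A perfect $7^{th}$ power is the seventh power of an integer. A finite set $B$ of nonzero integers is a locally $7^{th}$ power set if it contains no perfect $7^{th}$ power but, for all but finitely many primes $p$, some element of $B$ is a $7^{th}$ power modulo $p$. For $b=\prod_i p_i^{a_i}>0$, $\mathrm{rad}_7(b)=\prod_i p_i^{a_i\bmod 7}$. Geometric $7$-equivalence: for finite sets $B,B'$ of nonzero integers containing no perfect $7^{th}$ power, let $p_1,\dots,p_k$ be all primes dividing some $\mathrm{rad}_7(|b|)$, $b\in B\cup B'$; to each $b$ with $\mathrm{rad}_7(|b|)=\prod_i p_i^{\nu_i}$ associate the point $\langle(\nu_1,\dots,\nu_k)\rangle_{\mathbb{F}_7}\in\mathrm{PG}(\mathbb{F}_7^k)$, giving point sets $\mathcal{S},\mathcal{S}'$; $B,B'$ are geometrically $7$-equivalent iff $\Psi(\mathcal{S})=\mathcal{S}'$ for some $\Psi\in\mathrm{PGL}(k,7)$. *)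

theory Defs
  imports
    "HOL-Number_Theory.Number_Theory"
    "HOL-Library.Numeral_Type"
    "HOL-Library.FuncSet"
    "Jordan_Normal_Form.Matrix"
begin

definition perfect_7th_power :: "int \<Rightarrow> bool" where
  "perfect_7th_power b \<longleftrightarrow> (\<exists>x. b = x ^ 7)"

definition is_7th_power_mod :: "int \<Rightarrow> int \<Rightarrow> bool" where
  "is_7th_power_mod p b \<longleftrightarrow> (\<exists>x. [x ^ 7 = b] (mod p))"

definition locally_7th_power_set :: "int set \<Rightarrow> bool" where
  "locally_7th_power_set B \<longleftrightarrow>
     finite B \<and> 0 \<notin> B \<and> (\<forall>b\<in>B. \<not> perfect_7th_power b) \<and>
     finite {p. prime p \<and> \<not> (\<exists>b\<in>B. is_7th_power_mod p b)}"

definition rad7 :: "nat \<Rightarrow> nat" where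
  "rad7 b = (\<Prod>p\<in>prime_factors b. p ^ (multiplicity p b mod 7))"

(* The numeral type 7 is the ring of integers modulo 7, so it serves as the field with 7
   elements. The library gives it only a commutative ring instance; the next lemma records
   that it is a field. *)

lemma F7_inverse:
  fixes a :: 7
  assumes "a \<noteq> 0"
  shows "\<exists>b. a * b = 1"
proof -
  have seven: "of_int 7 = (0 :: 7)" by simp
  have mod7: "(of_int (m mod 7) :: 7) = of_int m" for m
  proof -
    have "(of_int m :: 7) = of_int (7 * (m div 7) + m mod 7)" by simp
    also have "\<dots> = of_int (m mod 7)" unfolding of_int_add of_int_mult seven by simp
    finally show ?thesis by simp
  qed
  obtain z where z: "a = of_int z" "0 \<le> z" "z < 7"
    by (cases a) auto
  with assms have "z \<noteq> 0" by auto
  with z have "z \<in> {1, 2, 3, 4, 5, 6}" by auto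
  then have "(z * z ^ 5) mod 7 = 1" by auto
  then have "a * of_int (z ^ 5) = 1"
    using mod7[of "z * z ^ 5"] z(1) by simp
  then show ?thesis by blast
qed

(* A projective point is a one-dimensional subspace, as a set of vectors. *)

definition proj_point :: "7 vec \<Rightarrow> 7 vec set" where
  "proj_point v = {c \<cdot>\<^sub>v v | c. True}"

definition PG :: "nat \<Rightarrow> 7 vec set set" where
  "PG k = {proj_point v | v. v \<in> carrier_vec k \<and> v \<noteq> 0\<^sub>v k}"

(* PGL(k, 7) as the group of projectivities: matrices differing by a nonzero scalar induce the
   same map on points, so this is the quotient of GL(k, 7) by scalars in its action on PG k. *)

definition PGL :: "nat \<Rightarrow> (7 vec set \<Rightarrow> 7 vec set) set" where
  "PGL k = {(\<lambda>X\<in>PG k. (\<lambda>v. A *\<^sub>v v) ` X) | A. A \<in> carrier_mat k k \<and> invertible_mat A}"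

definition rad7_primes :: "int set \<Rightarrow> nat set" where
  "rad7_primes B = {p. prime p \<and> (\<exists>b\<in>B. p dvd rad7 (nat \<bar>b\<bar>))}"

definition exponent_vec :: "nat list \<Rightarrow> int \<Rightarrow> 7 vec" where
  "exponent_vec ps b = vec (length ps) (\<lambda>i. of_nat (multiplicity (ps ! i) (rad7 (nat \<bar>b\<bar>))))"

definition point_set :: "nat list \<Rightarrow> int set \<Rightarrow> 7 vec set set" where
  "point_set ps B = (\<lambda>b. proj_point (exponent_vec ps b)) ` B"

(* Meant for finite sets of nonzero integers containing no perfect 7th power; for these every
   exponent vector is nonzero, so the point sets lie in PG k. The primes are listed in
   increasing order; another order only permutes coordinates, which PGL k absorbs. *)

definition geometrically_7_equivalent :: "int set \<Rightarrow> int set \<Rightarrow> bool" where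
  "geometrically_7_equivalent B B' \<longleftrightarrow>
     (let ps = sorted_list_of_set (rad7_primes (B \<union> B'))
      in \<exists>\<Psi>\<in>PGL (length ps). \<Psi> ` point_set ps B = point_set ps B')"

end

(* For a monomial p^a q^b r^c with discrete logarithms x, y, z of p, q, r modulo a prime s, the
   residue is a 7th power as soon as 7 divides a x + b y + c z. Hence a set of monomials is a
   locally 7th power set once its exponent triples, seen as points of the projective plane over
   F_7, meet every line. A projectivity preserves collinearity, so the two sets are
   inequivalent: (1,0,0), (0,1,0), (1,3,0), (1,5,0), (1,6,0) are five collinear points of B1,
   while no line contains more than four points of B2. *)

theory Submission
  imports Defs
begin

section \<open>Arithmetic in the field with seven elements\<close>

lemma of_int_F7_eq_0_iff: "(of_int z :: 7) = 0 \<longleftrightarrow> 7 dvd z"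
proof -
  have seven: "of_int 7 = (0 :: 7)" by simp
  have "(of_int z :: 7) = of_int (7 * (z div 7) + z mod 7)" by simp
  also have "\<dots> = of_int (z mod 7)" unfolding of_int_add of_int_mult seven by simp
  finally have eq: "(of_int z :: 7) = of_int (z mod 7)" .
  have "z mod 7 \<in> {0, 1, 2, 3, 4, 5, 6}" by auto
  with eq show ?thesis by (auto simp: dvd_eq_mod_eq_0)
qed

lemma of_nat_F7_mod: "(of_nat (n mod 7) :: 7) = of_nat n"
proof -
  have "7 dvd int (n mod 7) - int n"
    by (metis mod_eq_dvd_iff of_nat_mod mod_mod_trivial of_nat_numeral)
  then have "(of_int (int (n mod 7) - int n) :: 7) = 0"
    by (simp only: of_int_F7_eq_0_iff)
  then show ?thesis by simp
qed

text \<open>Units are not zero divisors. This cancels the unknown nonzero scalars of projective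
  points from minors and determinants.\<close>

lemma F7_mult_eq_0_iff:
  fixes a b :: 7
  shows "a * b = 0 \<longleftrightarrow> a = 0 \<or> b = 0"
proof -
  have False if ab: "a * b = 0" and "a \<noteq> 0" "b \<noteq> 0"
  proof -
    obtain c where "a * c = 1" using F7_inverse \<open>a \<noteq> 0\<close> by blast
    then have "b = (a * b) * c" by (metis mult.commute mult.left_commute mult_1)
    then show False using ab \<open>b \<noteq> 0\<close> by simp
  qed
  then show ?thesis by auto
qed

section \<open>Radicals and exponent vectors\<close>

lemma multiplicity_rad7:
  assumes "prime p" "b \<noteq> 0"
  shows "multiplicity p (rad7 b) = multiplicity p b mod 7"
  unfolding rad7_def using assms
  by (subst multiplicity_prod_prime_powers)
     (auto simp: in_prime_factors_iff not_dvd_imp_multiplicity_0)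

lemma rad7_neq_0: "rad7 b \<noteq> 0"
  unfolding rad7_def by (auto simp: in_prime_factors_iff)

text \<open>Finiteness ensures that \<open>sorted_list_of_set\<close> really lists these
  primes.\<close>

lemma finite_rad7_primes:
  assumes "finite B"
  shows "finite (rad7_primes B)"
proof -
  have "rad7_primes B \<subseteq> (\<Union>b\<in>B. {p. p dvd rad7 (nat \<bar>b\<bar>)})"
    by (auto simp: rad7_primes_def)
  moreover have "finite {p. p dvd rad7 (nat \<bar>b\<bar>)}" for b
    by (rule finite_divisors_nat) (use rad7_neq_0[of "nat \<bar>b\<bar>"] in simp)
  ultimately show ?thesis using assms by (auto intro: finite_subset)
qed

lemma multiplicity_nat_abs:
  "multiplicity p (nat \<bar>b\<bar>) = multiplicity (int p) b"
proof -
  have "p ^ n dvd nat \<bar>b\<bar> \<longleftrightarrow> int p ^ n dvd b" for n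
    by (metis abs_ge_zero dvd_abs_iff int_dvd_int_iff int_nat_eq of_nat_power)
  then show ?thesis by (simp add: multiplicity_def)
qed

lemma exponent_vec_carrier [simp]: "exponent_vec ps b \<in> carrier_vec (length ps)"
  by (simp add: exponent_vec_def)

lemma dim_exponent_vec [simp]: "dim_vec (exponent_vec ps b) = length ps"
  by (simp add: exponent_vec_def)

text \<open>The cast into the type \<open>7\<close> absorbs the reduction modulo 7 in
  \<open>rad7\<close>. Coordinates are thus plain multiplicities, which makes products of integers
  into sums of vectors.\<close>

lemma exponent_vec_index:
  assumes "i < length ps" "prime (ps ! i)" "b \<noteq> 0"
  shows "exponent_vec ps b $ i = of_nat (multiplicity (int (ps ! i)) b)"
  using assms
  by (simp add: exponent_vec_def multiplicity_rad7 of_nat_F7_mod multiplicity_nat_abs)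

lemma exponent_vec_mult:
  assumes "\<And>i. i < length ps \<Longrightarrow> prime (ps ! i)" "x \<noteq> 0" "y \<noteq> 0"
  shows "exponent_vec ps (x * y) = exponent_vec ps x + exponent_vec ps y"
proof (rule eq_vecI)
  fix i assume "i < dim_vec (exponent_vec ps x + exponent_vec ps y)"
  then have i: "i < length ps" by simp
  then have "prime (int (ps ! i))" using assms by simp
  then show "exponent_vec ps (x * y) $ i = (exponent_vec ps x + exponent_vec ps y) $ i"
    using i assms
    by (simp add: exponent_vec_index prime_elem_multiplicity_mult_distrib)
qed simp

lemma exponent_vec_power:
  assumes "\<And>i. i < length ps \<Longrightarrow> prime (ps ! i)" "x \<noteq> 0"
  shows "exponent_vec ps (x ^ n) = of_nat n \<cdot>\<^sub>v exponent_vec ps x"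
proof (rule eq_vecI)
  fix i assume "i < dim_vec (of_nat n \<cdot>\<^sub>v exponent_vec ps x)"
  then have i: "i < length ps" by simp
  then have "prime (int (ps ! i))" using assms by simp
  then show "exponent_vec ps (x ^ n) $ i = (of_nat n \<cdot>\<^sub>v exponent_vec ps x) $ i"
    using i assms
    by (simp add: exponent_vec_index prime_elem_multiplicity_power_distrib)
qed simp

section \<open>Linear algebra behind collinearity\<close>

lemma mult_mat_vec_smult:
  fixes A :: "'a :: comm_ring_1 mat"
  assumes "A \<in> carrier_mat m n" "v \<in> carrier_vec n"
  shows "A *\<^sub>v (k \<cdot>\<^sub>v v) = k \<cdot>\<^sub>v (A *\<^sub>v v)"
  using assms by (intro eq_vecI) auto

lemma minor_eq_0_of_proportional:
  fixes k k' :: "'a :: comm_ring_1"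
  assumes "k' * a1 = k * b1" "k' * a2 = k * b2"
  shows "k' * (a1 * b2 - b1 * a2) = 0"
proof -
  have "k' * (a1 * b2 - b1 * a2) = (k' * a1) * b2 - b1 * (k' * a2)"
    by (simp add: algebra_simps)
  also have "\<dots> = 0" unfolding assms by (simp add: algebra_simps)
  finally show ?thesis .
qed

text \<open>The determinant is linear in each row, so \<open>k0\<close>, \<open>k1\<close>,
  \<open>k2\<close> move into the rows. The scaled rows all lie in the span of the same two vectors,
  so they are dependent.\<close>

lemma det_eq_0_of_common_span:
  fixes k0 k1 k2 :: "'a :: comm_ring_1"
  assumes "k0 * a1 = s0 * x1 + t0 * y1" "k1 * b1 = s1 * x1 + t1 * y1" "k2 * d1 = s2 * x1 + t2 * y1"
    and "k0 * a2 = s0 * x2 + t0 * y2" "k1 * b2 = s1 * x2 + t1 * y2" "k2 * d2 = s2 * x2 + t2 * y2"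
    and "k0 * a3 = s0 * x3 + t0 * y3" "k1 * b3 = s1 * x3 + t1 * y3" "k2 * d3 = s2 * x3 + t2 * y3"
  shows "k0 * (k1 * (k2 * (a1 * (b2 * d3 - b3 * d2) - a2 * (b1 * d3 - b3 * d1)
    + a3 * (b1 * d2 - b2 * d1)))) = 0"
    (is "?lhs = 0")
proof -
  have "?lhs = (k0 * a1) * ((k1 * b2) * (k2 * d3) - (k1 * b3) * (k2 * d2))
      - (k0 * a2) * ((k1 * b1) * (k2 * d3) - (k1 * b3) * (k2 * d1))
      + (k0 * a3) * ((k1 * b1) * (k2 * d2) - (k1 * b2) * (k2 * d1))"
    by (simp add: algebra_simps)
  also have "\<dots> = 0" unfolding assms by (simp add: algebra_simps)
  finally show ?thesis .
qed

lemma mem_proj_point_self: "v \<in> proj_point v"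
  unfolding proj_point_def by (auto intro!: exI[of _ 1])

section \<open>Discrete logarithms modulo a prime\<close>

lemma prime_int_discrete_log:
  fixes p :: int
  assumes "prime p"
  obtains g where "\<And>a. \<not> p dvd a \<Longrightarrow> \<exists>e. [a = g ^ e] (mod p)"
proof -
  define q where "q = nat p"
  have q: "prime q" "p = int q" "q > 1"
    using assms by (auto simp: q_def prime_nat_iff_prime prime_gt_1_int prime_ge_0_int)
  obtain g where g: "residue_primroot q g"
    using prime_primitive_root_exists[of q] q by auto
  have "\<exists>e. [a = int g ^ e] (mod p)" if "\<not> p dvd a" for a
  proof -
    define r where "r = nat (a mod p)"
    have r: "int r = a mod p" using q by (simp add: r_def)
    have "\<not> p dvd a mod p" using that by (simp add: dvd_mod_iff)
    then have "\<not> q dvd r" using r q by (metis int_dvd_int_iff)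
    moreover have "r < q" using r q by (metis of_nat_0_less_iff of_nat_less_iff pos_mod_bound prime_gt_0_nat)
    \<comment> \<open>The powers of a primitive root run through exactly the residues prime to
      \<open>q\<close>.\<close>
    ultimately have "r \<in> totatives q"
      using q by (auto simp: totatives_def prime_imp_coprime coprime_commute intro!: gr0I)
    then obtain e where "r = g ^ e mod q"
      using residue_primroot_is_generator[OF q(3) g] by (auto simp: bij_betw_def)
    then have "a mod p = int g ^ e mod p"
      using r q by (simp add: zmod_int)
    then show ?thesis by (auto simp: cong_def)
  qed
  then show ?thesis using that by blast
qed

section \<open>Exponent triples and lines of the projective plane\<close>

definition monomial3 :: "int \<Rightarrow> int \<Rightarrow> int \<Rightarrow> nat \<times> nat \<times> nat \<Rightarrow> int" where
  "monomial3 p q r = (\<lambda>(a, b, c). p ^ a * q ^ b * r ^ c)"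

text \<open>It vanishes modulo 7 exactly when the triples are linearly dependent over F_7; for
  points this is collinearity. Integer values allow evaluation before reduction.\<close>

definition det3 :: "nat \<times> nat \<times> nat \<Rightarrow> nat \<times> nat \<times> nat \<Rightarrow> nat \<times> nat \<times> nat \<Rightarrow> int" where
  "det3 = (\<lambda>(a, b, c) (a', b', c') (a'', b'', c'').
     int a * (int b' * int c'' - int c' * int b'')
     - int b * (int a' * int c'' - int c' * int a'')
     + int c * (int a' * int b'' - int b' * int a''))"

text \<open>For triples with last entry 0, nonvanishing modulo 7 says that they give two distinct
  points.\<close>

definition minor12 :: "nat \<times> nat \<times> nat \<Rightarrow> nat \<times> nat \<times> nat \<Rightarrow> int" where
  "minor12 = (\<lambda>(a, b, c) (a', b', c'). int a * int b' - int a' * int b)"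

text \<open>The lines with a zero coefficient meet the three unit points, and every other line can be
  scaled so that its last coefficient is 1.\<close>

definition meets_generic_lines :: "(nat \<times> nat \<times> nat) set \<Rightarrow> bool" where
  "meets_generic_lines T \<longleftrightarrow>
     (\<forall>x\<in>{1, 2, 3, 4, 5, 6}. \<forall>y\<in>{1, 2, 3, 4, 5, 6}. \<exists>(a, b, c)\<in>T. 7 dvd a * x + b * y + c)"

lemma meets_line:
  assumes units: "{(1, 0, 0), (0, 1, 0), (0, 0, 1)} \<subseteq> T" and T: "meets_generic_lines T"
  shows "\<exists>a b c. (a, b, c) \<in> T \<and> 7 dvd a * x + b * y + c * z"
proof (cases "7 dvd x \<or> 7 dvd y \<or> 7 dvd z")
  case True
  then have "7 dvd 1 * x + 0 * y + 0 * z \<or> 7 dvd 0 * x + 1 * y + 0 * z \<or> 7 dvd 0 * x + 0 * y + 1 * z"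
    by simp
  then show ?thesis using units by (elim disjE) (blast, blast, blast)
next
  case False
  have "prime (7 :: nat)" by simp
  then have "coprime 7 z" using False by (intro prime_imp_coprime) auto
  then have "coprime z 7" by (simp only: coprime_commute)
  \<comment> \<open>Multiplying the equation by the inverse \<open>k\<close> of \<open>z\<close>
    keeps the line and makes its last coefficient 1.\<close>
  then obtain k where k: "[z * k = 1] (mod 7)" using cong_solve_coprime_nat[of z 7] by auto
  have "\<not> 7 dvd k"
  proof
    assume "7 dvd k"
    then have "7 dvd z * k" by simp
    with k show False by (simp add: cong_def)
  qed
  have range: "n * k mod 7 \<in> {1, 2, 3, 4, 5, 6}" if "\<not> 7 dvd n" for n
  proof -
    have "\<not> 7 dvd n * k" using \<open>prime 7\<close> that \<open>\<not> 7 dvd k\<close> by (simp add: prime_dvd_mult_iff)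
    then have "n * k mod 7 \<noteq> 0" "n * k mod 7 < 7" by (auto simp: dvd_eq_mod_eq_0)
    then show ?thesis unfolding insert_iff empty_iff by linarith
  qed
  have "\<exists>(a, b, c)\<in>T. 7 dvd a * (x * k mod 7) + b * (y * k mod 7) + c"
    using T[unfolded meets_generic_lines_def] range[of x] range[of y] False by blast
  then obtain a b c where
    abc: "(a, b, c) \<in> T" "7 dvd a * (x * k mod 7) + b * (y * k mod 7) + c * 1"
    by auto
  have "[a * (x * k mod 7) + b * (y * k mod 7) + c * 1 = a * (x * k) + b * (y * k) + c * (z * k)] (mod 7)"
    by (intro cong_add cong_mult cong_refl cong_sym[OF k]) (simp_all add: cong_def)
  with abc(2) have "7 dvd a * (x * k) + b * (y * k) + c * (z * k)"
    by (simp only: cong_def dvd_eq_mod_eq_0)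
  then have "7 dvd (a * x + b * y + c * z) * k" by (simp add: algebra_simps)
  then have "7 dvd a * x + b * y + c * z"
    using \<open>prime 7\<close> \<open>\<not> 7 dvd k\<close> by (simp only: prime_dvd_mult_iff simp_thms)
  with abc(1) show ?thesis by blast
qed

section \<open>Monomials in three distinct primes\<close>

locale three_primes =
  fixes p q r :: int
  assumes primes: "prime p" "prime q" "prime r"
    and distinct: "p \<noteq> q" "p \<noteq> r" "q \<noteq> r"
begin

abbreviation "M \<equiv> monomial3 p q r"

lemma nonzero: "p \<noteq> 0" "q \<noteq> 0" "r \<noteq> 0"
  using primes by auto

lemma M_nonzero: "M t \<noteq> 0"
  using nonzero by (auto simp: monomial3_def split: prod.split)

lemma multiplicity_M:
  "multiplicity p (M (a, b, c)) = a"
  "multiplicity q (M (a, b, c)) = b"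
  "multiplicity r (M (a, b, c)) = c"
  using primes[THEN prime_imp_prime_elem] primes distinct nonzero
  by (simp_all add: monomial3_def prime_elem_multiplicity_mult_distrib
        multiplicity_distinct_prime_power prime_ge_0_int)

lemma inj_M: "inj M"
proof (rule injI)
  fix s t assume "M s = M t"
  then show "s = t" using multiplicity_M by (cases s; cases t) metis
qed

lemma not_perfect_7th_power_M:
  assumes "\<not> (7 dvd a \<and> 7 dvd b \<and> 7 dvd c)"
  shows "\<not> perfect_7th_power (M (a, b, c))"
proof
  assume "perfect_7th_power (M (a, b, c))"
  then obtain x where x: "M (a, b, c) = x ^ 7" by (auto simp: perfect_7th_power_def)
  then have "x \<noteq> 0" using M_nonzero[of "(a, b, c)"] by auto
  then have "7 dvd multiplicity s (M (a, b, c))" if "prime s" for s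
    using that x \<open>x \<noteq> 0\<close> prime_elem_multiplicity_power_distrib[of s x 7]
    by (simp add: prime_ge_0_int)
  then show False using assms primes multiplicity_M by metis
qed

lemma M_7th_power_mod:
  assumes T: "{(1, 0, 0), (0, 1, 0), (0, 0, 1)} \<subseteq> T" "meets_generic_lines T" and s: "prime s"
  shows "\<exists>b\<in>M ` T. is_7th_power_mod s b"
proof (cases "s \<in> {p, q, r}")
  case True
  \<comment> \<open>Here \<open>s\<close> is the monomial of a unit triple and is congruent to
    \<open>0 ^ 7\<close> modulo itself, so \<open>p\<close>, \<open>q\<close>, \<open>r\<close> are
    not exceptional primes.\<close>
  then have "s \<in> M ` T"
    using T(1) by (force simp: monomial3_def image_iff)
  moreover have "is_7th_power_mod s s"
    unfolding is_7th_power_mod_def by (rule exI[of _ 0]) (simp add: cong_def)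
  ultimately show ?thesis by blast
next
  case False
  then have "\<not> s dvd p" "\<not> s dvd q" "\<not> s dvd r"
    using primes s by (auto simp: primes_dvd_imp_eq)
  moreover obtain g where "\<And>a. \<not> s dvd a \<Longrightarrow> \<exists>e. [a = g ^ e] (mod s)"
    using prime_int_discrete_log[OF s] by blast
  ultimately have "\<exists>x y z. [p = g ^ x] (mod s) \<and> [q = g ^ y] (mod s) \<and> [r = g ^ z] (mod s)"
    by blast
  then obtain x y z where xyz: "[p = g ^ x] (mod s)" "[q = g ^ y] (mod s)" "[r = g ^ z] (mod s)"
    by blast
  obtain a b c where abc: "(a, b, c) \<in> T" "7 dvd a * x + b * y + c * z"
    using meets_line[OF T] by blast
  then obtain m where m: "x * a + y * b + z * c = m * 7"
    by (metis dvd_def mult.commute)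
  \<comment> \<open>Written through the primitive root \<open>g\<close>, the monomial has exponent
    \<open>m * 7\<close>.\<close>
  have "[p ^ a * q ^ b * r ^ c = (g ^ x) ^ a * (g ^ y) ^ b * (g ^ z) ^ c] (mod s)"
    by (intro cong_mult cong_pow xyz)
  also have "(g ^ x) ^ a * (g ^ y) ^ b * (g ^ z) ^ c = (g ^ m) ^ 7"
    by (simp flip: power_mult power_add add: m)
  finally have "is_7th_power_mod s (M (a, b, c))"
    unfolding is_7th_power_mod_def monomial3_def by (auto intro: cong_sym)
  then show ?thesis using abc by blast
qed

lemma locally_7th_power_set_M:
  assumes "finite T" "{(1, 0, 0), (0, 1, 0), (0, 0, 1)} \<subseteq> T" "meets_generic_lines T"
    and "\<forall>(a, b, c)\<in>T. \<not> (7 dvd a \<and> 7 dvd b \<and> 7 dvd c)"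
  shows "locally_7th_power_set (M ` T)"
proof -
  have good: "{s. prime s \<and> \<not> (\<exists>b\<in>M ` T. is_7th_power_mod s b)} = {}"
    using M_7th_power_mod[OF assms(2,3)] by blast
  have "0 \<notin> M ` T" using M_nonzero by (metis imageE)
  moreover have "\<not> perfect_7th_power (M t)" if "t \<in> T" for t
  proof -
    obtain a b c where t: "t = (a, b, c)" by (rule prod_cases3)
    then show ?thesis using assms(4) that not_perfect_7th_power_M[of a b c] by auto
  qed
  ultimately show ?thesis
    unfolding locally_7th_power_set_def good using assms(1) by auto
qed

text \<open>\<open>K\<close> supplies more than \<open>m\<close> distinct points of \<open>T\<close>
  on the line with last coordinate 0, while a line through two points of \<open>T'\<close> carries
  at most \<open>m\<close> of them. A projectivity would map \<open>K\<close> injectively into such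
  a line.\<close>

lemma not_geometrically_7_equivalent_M:
  assumes fin: "finite T" "finite T'"
    and units: "{(1, 0, 0), (0, 1, 0), (0, 0, 1)} \<subseteq> T"
    and K: "K \<subseteq> T" "\<And>a b c. (a, b, c) \<in> K \<Longrightarrow> c = 0" "m < card K" "1 < card K"
    and K_minor: "\<And>t t'. t \<in> K \<Longrightarrow> t' \<in> K \<Longrightarrow> t \<noteq> t' \<Longrightarrow> \<not> 7 dvd minor12 t t'"
    and T': "\<And>t t'. t \<in> T' \<Longrightarrow> t' \<in> T' \<Longrightarrow> t \<noteq> t' \<Longrightarrow> card {t''\<in>T'. 7 dvd det3 t t' t''} \<le> m"
  shows "\<not> geometrically_7_equivalent (M ` T) (M ` T')"
proof
  assume "geometrically_7_equivalent (M ` T) (M ` T')"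
  define ps where "ps = sorted_list_of_set (rad7_primes (M ` T \<union> M ` T'))"
  define n where "n = length ps"
  define w where "w t = exponent_vec ps (M t)" for t
  have w_carrier [simp]: "w t \<in> carrier_vec n" for t by (simp add: w_def n_def)
  have set_ps: "set ps = rad7_primes (M ` T \<union> M ` T')"
    unfolding ps_def using fin by (simp add: finite_rad7_primes)
  have prime_ps: "prime (ps ! i)" if "i < length ps" for i
    using nth_mem[OF that] by (auto simp: set_ps rad7_primes_def)
  have in_ps: "nat s \<in> set ps" if "prime s" "s \<in> M ` T" for s
  proof -
    have s: "prime (nat s)" "s \<ge> 0" using that by (auto simp: prime_nat_iff_prime prime_ge_0_int)
    then have "multiplicity (nat s) (rad7 (nat s)) = 1"
      by (subst multiplicity_rad7) auto
    then have "nat s dvd rad7 (nat \<bar>s\<bar>)" using s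
      by (metis abs_of_nonneg not_dvd_imp_multiplicity_0 zero_neq_one)
    then show ?thesis using that s(1) unfolding set_ps rad7_primes_def by blast
  qed
  have in_T: "p \<in> M ` T" "q \<in> M ` T" "r \<in> M ` T"
    using units by (force simp: monomial3_def image_iff)+
  \<comment> \<open>The order of \<open>p\<close>, \<open>q\<close>, \<open>r\<close> in the sorted
    list depends on their sizes, so their positions are only named.\<close>
  obtain i1 i2 i3 where i: "i1 < n" "i2 < n" "i3 < n"
    and ps_i: "ps ! i1 = nat p" "ps ! i2 = nat q" "ps ! i3 = nat r"
    using in_ps in_T primes by (metis in_set_conv_nth n_def)
  have int_ps: "int (ps ! i1) = p" "int (ps ! i2) = q" "int (ps ! i3) = r"
    using ps_i primes by (simp_all add: prime_ge_0_int)
  have w_index: "w (a, b, c) $ i1 = of_nat a" "w (a, b, c) $ i2 = of_nat b"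
      "w (a, b, c) $ i3 = of_nat c" for a b c
    using i prime_ps int_ps
    by (simp_all add: w_def exponent_vec_index n_def M_nonzero multiplicity_M)
  define u1 u2 where "u1 = exponent_vec ps p" and "u2 = exponent_vec ps q"
  have u [simp]: "u1 \<in> carrier_vec n" "u2 \<in> carrier_vec n"
    by (simp_all add: u1_def u2_def n_def)
  have w_K: "w (a, b, 0) = of_nat a \<cdot>\<^sub>v u1 + of_nat b \<cdot>\<^sub>v u2" for a b
    using nonzero prime_ps
    by (simp add: w_def u1_def u2_def monomial3_def exponent_vec_mult exponent_vec_power)
  obtain t0 t1 where t01: "t0 \<in> K" "t1 \<in> K" "t0 \<noteq> t1"
    using K(4) by (metis card_le_Suc0_iff_eq card.infinite not_less One_nat_def not_one_less_zero)
  \<comment> \<open>A zero vector would make every minor with \<open>t\<close> vanish, yet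
    \<open>t0\<close> or \<open>t1\<close> differs from \<open>t\<close>.\<close>
  have w_nonzero: "w t \<noteq> 0\<^sub>v n" if "t \<in> K" for t
  proof
    assume 0: "w t = 0\<^sub>v n"
    obtain a b c where t: "t = (a, b, c)" by (cases t)
    have "7 dvd int a" "7 dvd int b"
      using w_index[of a b c] 0 i t of_int_F7_eq_0_iff[of "int a"] of_int_F7_eq_0_iff[of "int b"] by simp_all
    then have "7 dvd minor12 t t'" for t'
      by (auto simp: minor12_def t split: prod.split)
    then show False using t01 K_minor that by metis
  qed
  from \<open>geometrically_7_equivalent (M ` T) (M ` T')\<close> obtain A where
    A: "A \<in> carrier_mat n n" "invertible_mat A"
    and img: "(\<lambda>X\<in>PG n. (\<lambda>v. A *\<^sub>v v) ` X) ` point_set ps (M ` T) = point_set ps (M ` T')"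
    unfolding geometrically_7_equivalent_def Let_def ps_def[symmetric] PGL_def n_def[symmetric]
    by blast
  obtain A' where A': "A' \<in> carrier_mat n n" "A' * A = 1\<^sub>m n"
  proof -
    from A obtain C where C: "A * C = 1\<^sub>m n" "C * A = 1\<^sub>m (dim_row C)"
      unfolding invertible_mat_def inverts_mat_def by auto
    \<comment> \<open>The shape of the inverse is read off by comparing dimensions in the two
      products.\<close>
    then have "dim_col C = n" "dim_row C = n"
      using A by (metis index_mult_mat(3) index_one_mat(3) carrier_matD(2))+
    then show ?thesis using that C by (metis carrier_matI)
  qed
  have A_inj: "v = v'" if "A *\<^sub>v v = A *\<^sub>v v'" "v \<in> carrier_vec n" "v' \<in> carrier_vec n" for v v'
  proof -
    have "A' *\<^sub>v (A *\<^sub>v u) = u" if "u \<in> carrier_vec n" for u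
      using that A(1) A' by (simp flip: assoc_mult_mat_vec)
    then show ?thesis using that by metis
  qed
  have "\<exists>t'\<in>T'. \<exists>c. A *\<^sub>v w t = c \<cdot>\<^sub>v w t'" if "t \<in> K" for t
  proof -
    \<comment> \<open>A projectivity is a function restricted to \<open>PG n\<close>; only there
      does it act as the image under \<open>A\<close>.\<close>
    have "proj_point (w t) \<in> PG n"
      using w_nonzero[OF that] by (auto simp: PG_def)
    moreover have "proj_point (w t) \<in> point_set ps (M ` T)"
      using that K(1) by (auto simp: point_set_def w_def)
    ultimately have "(\<lambda>v. A *\<^sub>v v) ` proj_point (w t) \<in> point_set ps (M ` T')"
      by (subst img[symmetric]) (auto intro!: rev_image_eqI)
    then obtain t' where "t' \<in> T'" "(\<lambda>v. A *\<^sub>v v) ` proj_point (w t) = proj_point (w t')"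
      by (auto simp: point_set_def w_def)
    then show ?thesis
      using mem_proj_point_self[of "w t"] unfolding proj_point_def by blast
  qed
  then obtain f c where f: "\<And>t. t \<in> K \<Longrightarrow> f t \<in> T'"
    and c: "\<And>t. t \<in> K \<Longrightarrow> A *\<^sub>v w t = c t \<cdot>\<^sub>v w (f t)"
    by metis
  have c_nonzero: "c t \<noteq> 0" if "t \<in> K" for t
  proof
    assume "c t = 0"
    then have "A *\<^sub>v w t = A *\<^sub>v 0\<^sub>v n"
      using c[OF that] A by (auto simp: mult_mat_vec_def carrier_vecD[OF w_carrier])
    from A_inj[OF this w_carrier zero_carrier_vec] w_nonzero[OF that]
    show False by contradiction
  qed
  have inj: "inj_on f K"
  proof (rule inj_onI, rule ccontr)
    fix t t' assume t: "t \<in> K" "t' \<in> K" "f t = f t'" "t \<noteq> t'"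
    obtain a1 a2 a3 b1 b2 b3 where ab: "t = (a1, a2, a3)" "t' = (b1, b2, b3)"
      by (metis prod_cases3)
    \<comment> \<open>If \<open>t\<close> and \<open>t'\<close> share an image, crosswise scaling
      equalizes the image vectors. Injectivity of \<open>A\<close> then makes \<open>w t\<close> and
      \<open>w t'\<close> proportional, against \<open>K_minor\<close>.\<close>
    have "A *\<^sub>v (c t' \<cdot>\<^sub>v w t) = A *\<^sub>v (c t \<cdot>\<^sub>v w t')"
      using A c[OF t(1)] c[OF t(2)] t(3)
      by (simp add: mult_mat_vec_smult[of _ n n] smult_smult_assoc mult.commute)
    then have eq: "c t' \<cdot>\<^sub>v w t = c t \<cdot>\<^sub>v w t'" by (rule A_inj) simp_all
    have "c t' * of_nat a1 = c t * of_nat b1" "c t' * of_nat a2 = c t * of_nat b2"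
      using arg_cong[OF eq, of "\<lambda>v. v $ i1"] arg_cong[OF eq, of "\<lambda>v. v $ i2"] i w_index
      by (simp_all add: ab carrier_vecD[OF w_carrier])
    then have "c t' * (of_nat a1 * of_nat b2 - of_nat b1 * of_nat a2) = 0"
      by (rule minor_eq_0_of_proportional)
    then have "(of_int (minor12 t t') :: 7) = 0"
      using c_nonzero[OF t(2)] by (simp add: F7_mult_eq_0_iff minor12_def ab)
    with K_minor[OF t(1,2,4)] show False by (simp only: of_int_F7_eq_0_iff)
  qed
  text \<open>The images of the points of \<open>K\<close> lie on the line spanned by the images of the first two
    unit vectors.\<close>
  define X Y where "X = A *\<^sub>v u1" and "Y = A *\<^sub>v u2"
  have coords: "c t * w (f t) $ j = of_nat (fst t) * X $ j + of_nat (fst (snd t)) * Y $ j"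
    if "t \<in> K" "j < n" for t j
  proof -
    obtain a b d where "t = (a, b, d)" by (rule prod_cases3)
    with K(2)[of a b d] that(1) have t: "t = (a, b, 0)" by simp
    have "A *\<^sub>v w t = of_nat a \<cdot>\<^sub>v X + of_nat b \<cdot>\<^sub>v Y"
      using A by (simp add: t w_K X_def Y_def mult_add_distrib_mat_vec[of _ n n]
          mult_mat_vec_smult[of _ n n])
    then have "(c t \<cdot>\<^sub>v w (f t)) $ j = (of_nat a \<cdot>\<^sub>v X + of_nat b \<cdot>\<^sub>v Y) $ j"
      using c[OF that(1)] by simp
    then show ?thesis
      using that A by (simp add: t X_def Y_def carrier_vecD[OF w_carrier])
  qed
  have "7 dvd det3 (f t0) (f t1) (f t)" if t: "t \<in> K" for t
  proof -
    obtain a1 a2 a3 b1 b2 b3 d1 d2 d3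
      where ft: "f t0 = (a1, a2, a3)" "f t1 = (b1, b2, b3)" "f t = (d1, d2, d3)"
      by (metis prod_cases3)
    note eqs = coords[OF t01(1)] coords[OF t01(2)] coords[OF t]
    \<comment> \<open>Only the coordinates \<open>i1\<close>, \<open>i2\<close>, \<open>i3\<close>
      enter; there all three image vectors, once scaled, are combinations of \<open>X\<close> and
      \<open>Y\<close>.\<close>
    have "c t0 * (c t1 * (c t *
        (of_nat a1 * (of_nat b2 * of_nat d3 - of_nat b3 * of_nat d2)
         - of_nat a2 * (of_nat b1 * of_nat d3 - of_nat b3 * of_nat d1)
         + of_nat a3 * (of_nat b1 * of_nat d2 - of_nat b2 * of_nat d1)))) = 0"
      by (rule det_eq_0_of_common_span; rule eqs[OF i(1), unfolded ft w_index]
          eqs[OF i(2), unfolded ft w_index] eqs[OF i(3), unfolded ft w_index])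
    then have "(of_int (det3 (f t0) (f t1) (f t)) :: 7) = 0"
      using c_nonzero t t01 by (simp add: F7_mult_eq_0_iff det3_def ft)
    then show ?thesis by (simp only: of_int_F7_eq_0_iff)
  qed
  then have "f ` K \<subseteq> {t''\<in>T'. 7 dvd det3 (f t0) (f t1) t''}" using f by auto
  then have "card (f ` K) \<le> card {t''\<in>T'. 7 dvd det3 (f t0) (f t1) t''}"
    using fin(2) by (intro card_mono) auto
  also have "\<dots> \<le> m"
    using T' f t01 inj by (simp add: inj_on_eq_iff)
  finally show False using inj K(3) by (simp add: card_image)
qed

end

section \<open>The two explicit sets\<close>

definition exponents_B1 :: "(nat \<times> nat \<times> nat) set" where
  "exponents_B1 = {(1,0,0), (0,1,0), (0,0,1), (1,3,0), (1,0,3), (0,1,3),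
         (1,5,0), (1,0,5), (0,1,5), (1,6,0), (1,0,6), (0,1,6)}"

text \<open>For \<open>w\<close> in {2, 4} these are the three unit points and, up to scalars modulo
  7, the nine points (1, w^i, w^j). The entry \<open>w^2\<close> is the integer 4 or 16, not its
  residue.\<close>

definition exponents_B2 :: "nat \<Rightarrow> (nat \<times> nat \<times> nat) set" where
  "exponents_B2 w = {(1,0,0), (0,1,0), (0,0,1), (1,1,1), (w^2,w,1), (w^2,1,w),
           (w,w,1), (1,w,1), (w,1,1), (w,1,w), (1,w,w), (1,1,w)}"

text \<open>This is the projective triangle. The line with coefficients (x, y, 1) meets the sides in
  (1, t, 0), (1, 0, t), (0, 1, t) for t = -x/y, -x, -y respectively. Since -1 is a nonsquare, t is
  one of the nonsquares 3, 5, 6 iff x/y, x, y respectively is a square, and one of these always is.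
  The proof runs through the 36 lines.\<close>

lemma meets_generic_lines_exponents_B1: "meets_generic_lines exponents_B1"
  unfolding meets_generic_lines_def
  by (intro ballI; elim insertE emptyE; hypsubst; simp add: exponents_B1_def)

text \<open>Every nonzero residue is a cube root of unity up to sign. Multiplying x and y by cube
  roots of unity thus reduces the equation to 1+2+4, 1+5+1, 5+1+1 or 3+3+1, all 0 modulo 7.\<close>

lemma meets_generic_lines_exponents_B2:
  assumes "w \<in> {2, 4}"
  shows "meets_generic_lines (exponents_B2 w)"
  using assms unfolding meets_generic_lines_def
  by (intro ballI; elim insertE emptyE; hypsubst; simp add: exponents_B2_def)

lemma card_Collect_mem_le_length_filter:
  "card {x \<in> set xs. P x} \<le> length (filter P xs)"
  by (metis card_length set_filter)

text \<open>A line through two unit points contains none of the other nine, a line through exactly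
  one contains at most three of them, and a line avoiding the unit points at most two. The proof
  enumerates all pairs.\<close>

lemma card_collinear_exponents_B2:
  assumes "w \<in> {2, 4}" "t \<in> exponents_B2 w" "t' \<in> exponents_B2 w" "t \<noteq> t'"
  shows "card {t''\<in>exponents_B2 w. 7 dvd det3 t t' t''} \<le> 4"
proof -
  have eq: "exponents_B2 w = set [(1,0,0), (0,1,0), (0,0,1), (1,1,1), (w^2,w,1), (w^2,1,w),
    (w,w,1), (1,w,1), (w,1,1), (w,1,w), (1,w,w), (1,1,w)]"
    by (simp add: exponents_B2_def)
  show ?thesis
    unfolding eq
    \<comment> \<open>Filtering an explicit list turns the cardinality into a length that
      simplification can evaluate.\<close>
    by (rule order_trans[OF card_Collect_mem_le_length_filter],
        insert assms, unfold eq list.set, elim insertE emptyE; hypsubst; simp add: det3_def)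
qed

theorem theorem6p6:
  fixes p1 p2 p3 :: int and \<omega> :: nat and B1 B2 :: "int set"
  assumes "prime p1" and "prime p2" and "prime p3"
    and "p1 \<noteq> p2" and "p1 \<noteq> p3" and "p2 \<noteq> p3"
    and "\<omega> \<in> {2, 4}" and "ord 7 \<omega> = 3"
    and "B1 = {p1, p2, p3, p1 * p2 ^ 3, p1 * p3 ^ 3, p2 * p3 ^ 3,
               p1 * p2 ^ 5, p1 * p3 ^ 5, p2 * p3 ^ 5,
               p1 * p2 ^ 6, p1 * p3 ^ 6, p2 * p3 ^ 6}"
    and "B2 = {p1, p2, p3, p1 * p2 * p3,
               p1 ^ (\<omega> ^ 2) * p2 ^ \<omega> * p3, p1 ^ (\<omega> ^ 2) * p2 * p3 ^ \<omega>,
               p1 ^ \<omega> * p2 ^ \<omega> * p3, p1 * p2 ^ \<omega> * p3, p1 ^ \<omega> * p2 * p3,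
               p1 ^ \<omega> * p2 * p3 ^ \<omega>, p1 * p2 ^ \<omega> * p3 ^ \<omega>, p1 * p2 * p3 ^ \<omega>}"
  shows "locally_7th_power_set B1 \<and> locally_7th_power_set B2 \<and>
         card B1 = 12 \<and> card B2 = 12 \<and> (12 :: rat) = 3 * (7 + 1) / 2 \<and>
         \<not> geometrically_7_equivalent B1 B2"
proof -
  interpret three_primes p1 p2 p3 by standard (use assms in auto)
  have B1: "B1 = M ` exponents_B1"
    unfolding assms(9) exponents_B1_def by (simp add: monomial3_def)
  have B2: "B2 = M ` exponents_B2 \<omega>"
    unfolding assms(10) exponents_B2_def by (simp add: monomial3_def)
  have card: "card exponents_B1 = 12" "card (exponents_B2 \<omega>) = 12"
    using assms(7) by (auto simp: exponents_B1_def exponents_B2_def)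
  have fin: "finite exponents_B1" "finite (exponents_B2 \<omega>)"
    by (simp_all add: exponents_B1_def exponents_B2_def)
  have inj: "inj_on M S" for S using inj_M by (rule inj_on_subset) simp
  have "locally_7th_power_set B1" unfolding B1
    by (rule locally_7th_power_set_M)
       (simp_all add: fin meets_generic_lines_exponents_B1,
        simp_all add: exponents_B1_def)
  moreover have "locally_7th_power_set B2" unfolding B2
    by (rule locally_7th_power_set_M)
       (simp_all add: fin meets_generic_lines_exponents_B2[OF assms(7)],
        use assms(7) in \<open>auto simp: exponents_B2_def\<close>)
  moreover have "card B1 = 12" "card B2 = 12"
    by (simp_all add: B1 B2 card card_image[OF inj])
  moreover have "\<not> geometrically_7_equivalent B1 B2"
    unfolding B1 B2
  \<comment> \<open>\<open>K\<close> consists of all triples of \<open>exponents_B1\<close> with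
    last entry 0, five against the bound 4.\<close>
  proof (rule not_geometrically_7_equivalent_M[OF fin, where
        K = "{(1,0,0), (0,1,0), (1,3,0), (1,5,0), (1,6,0)}" and m = 4])
    show "card {t''\<in>exponents_B2 \<omega>. 7 dvd det3 t t' t''} \<le> 4"
      if "t \<in> exponents_B2 \<omega>" "t' \<in> exponents_B2 \<omega>" "t \<noteq> t'" for t t'
      using that by (rule card_collinear_exponents_B2[OF assms(7)])
    show "\<not> 7 dvd minor12 t t'"
      if "t \<in> {(1,0,0), (0,1,0), (1,3,0), (1,5,0), (1,6,0)}"
        "t' \<in> {(1,0,0), (0,1,0), (1,3,0), (1,5,0), (1,6,0)}" "t \<noteq> t'" for t t'
      using that by (auto simp: minor12_def)
  qed (auto simp: exponents_B1_def)
  ultimately show ?thesis by simp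
qed

end
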